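(* Let $(x_i,r_i)_{i\in\mathcal{I}}$ be a homogeneous ubiquitous system in a nonempty open set $U\subseteq\mathbb{R}^d$. Then for every real $t>1$, the set $F_t\cap U$ has positive Hausdorff $g$-measure for the gauge function $g(r)=r^{d/t}|\log r|$; in particular $\dim_{\mathrm{H}}(F_t\cap U)\ge d/t$.
   Context: Fix a norm $|\cdot|$ on $\mathbb{R}^d$; $\mathcal{L}^d$ is Lebesgue measure. Let $\mathcal{I}$ be a countably infinite index set. A family $(x_i,r_i)_{i\in\mathcal{I}}$ in $\mathbb{R}^d\times(0,\infty)$ is an approximation system if $\sup_i r_i<\infty$ and for every $m\in\mathbb{N}$ the set $\{i\in\mathcal{I}: |x_i|<m,\ r_i>1/m\}$ is finite. For $t\ge1$, $F_t=\{x\in\mathbb{R}^d: |x-x_i|<r_i^t \text{ for infinitely many } i\in\mathcal{I}\}$. The approximation system is a homogeneous ubiquitous system in a nonempty open set $U$ if $F_1$ has full Lebesgue measure in $U$, i.e. $\mathcal{L}^d(U\setminus F_1)=0$. The Hausdorff $g$-measure is $\mathcal{H}^g(E)=\lim_{\delta\downarrow0}\inf\{\sum_n g(\mathrm{diam}\,C_n):E\subseteq\bigcup_nC_n,\ \mathrm{diam}\,C_n\le\delta\}$. *)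

theory Defs
  imports "HOL-Analysis.Analysis"
begin

definition is_norm :: "('a::real_vector \<Rightarrow> real) \<Rightarrow> bool" where
  "is_norm N \<longleftrightarrow> (\<forall>x. 0 \<le> N x) \<and> (\<forall>x. N x = 0 \<longleftrightarrow> x = 0)
     \<and> (\<forall>c x. N (c *\<^sub>R x) = \<bar>c\<bar> * N x) \<and> (\<forall>x y. N (x + y) \<le> N x + N y)"

definition approximation_system ::
  "('a::real_vector \<Rightarrow> real) \<Rightarrow> 'i set \<Rightarrow> ('i \<Rightarrow> 'a) \<Rightarrow> ('i \<Rightarrow> real) \<Rightarrow> bool" where
  "approximation_system N I x r \<longleftrightarrow>
     countable I \<and> infinite I \<and> (\<forall>i\<in>I. 0 < r i) \<and> bdd_above (r ` I) \<and>
     (\<forall>m::nat. finite {i\<in>I. N (x i) < real m \<and> r i > 1 / real m})"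

definition F_set ::
  "('a::real_vector \<Rightarrow> real) \<Rightarrow> 'i set \<Rightarrow> ('i \<Rightarrow> 'a) \<Rightarrow> ('i \<Rightarrow> real) \<Rightarrow> real \<Rightarrow> 'a set" where
  "F_set N I x r t = {y. infinite {i\<in>I. N (y - x i) < r i powr t}}"

definition homogeneous_ubiquitous ::
  "('a::euclidean_space \<Rightarrow> real) \<Rightarrow> 'i set \<Rightarrow> ('i \<Rightarrow> 'a) \<Rightarrow> ('i \<Rightarrow> real) \<Rightarrow> 'a set \<Rightarrow> bool" where
  "homogeneous_ubiquitous N I x r U \<longleftrightarrow>
     approximation_system N I x r \<and> open U \<and> U \<noteq> {} \<and>
     U - F_set N I x r 1 \<in> null_sets lebesgue"

definition diamN :: "('a::real_vector \<Rightarrow> real) \<Rightarrow> 'a set \<Rightarrow> real" where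
  "diamN N C = (if C = {} then 0 else Sup {N (a - b) |a b. a \<in> C \<and> b \<in> C})"

definition boundedN :: "('a::real_vector \<Rightarrow> real) \<Rightarrow> 'a set \<Rightarrow> bool" where
  "boundedN N C \<longleftrightarrow> bdd_above {N (a - b) |a b. a \<in> C \<and> b \<in> C}"

definition hausdorff_content_g ::
  "('a::real_vector \<Rightarrow> real) \<Rightarrow> (real \<Rightarrow> real) \<Rightarrow> real \<Rightarrow> 'a set \<Rightarrow> ennreal" where
  "hausdorff_content_g N g \<delta> E =
     (INF C \<in> {C :: nat \<Rightarrow> 'a set. E \<subseteq> (\<Union>n. C n) \<and>
                 (\<forall>n. boundedN N (C n) \<and> diamN N (C n) \<le> \<delta>)}.
        (\<Sum>n. ennreal (g (diamN N (C n)))))"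

text \<open>Hausdorff g-measure: the limit as delta decreases to 0, which (by monotonicity)
  equals the supremum over delta > 0.\<close>
definition hausdorff_g ::
  "('a::real_vector \<Rightarrow> real) \<Rightarrow> (real \<Rightarrow> real) \<Rightarrow> 'a set \<Rightarrow> ennreal" where
  "hausdorff_g N g E = (SUP \<delta>\<in>{0<..}. hausdorff_content_g N g \<delta> E)"

definition hausdorff_dim :: "('a::real_vector \<Rightarrow> real) \<Rightarrow> 'a set \<Rightarrow> ereal" where
  "hausdorff_dim N E =
     (INF s \<in> {s::real. 0 \<le> s \<and> hausdorff_g N (\<lambda>\<rho>. \<rho> powr s) E = 0}. ereal s)"

end

theory Submission
  imports Defs "HOL-Real_Asymp.Real_Asymp"
begin

text \<open>
  Given a cover of \<open>F\<^sub>t \<inter> U\<close> by sets \<open>E\<^sub>n\<close> of sizes \<open>s\<^sub>n\<close> with small total gauge, a point of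
  \<open>F\<^sub>t \<inter> U\<close> outside all \<open>E\<^sub>n\<close> is found in a nested sequence of balls adapted to the cover, so
  no measure on a Cantor set is needed. The invariant for a ball of radius \<open>\<rho>\<close> is that the sets
  \<open>E\<^sub>n\<close> meeting it have total gauge at most \<open>c g(\<rho>)\<close> with a fixed \<open>c < 1\<close>; by monotonicity of
  \<open>g\<close> all these sets have size at most \<open>\<rho>\<close>, which excludes every fixed \<open>E\<^sub>n\<close> in the limit.

  For the next ball, pack disjoint balls \<open>B(x\<^sub>j, r\<^sub>j)\<close> of the system into the current one, with
  \<open>r\<^sub>j\<close> tiny but \<open>\<Sum>r\<^sub>j\<^sup>d \<ge> c\<^sub>0 \<rho>\<^sup>d\<close>, and shrink them to radius \<open>r\<^sub>j\<^sup>t/2\<close>. If a set \<open>E\<^sub>n\<close> meets two or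
  more shrunken balls, then the \<open>r\<^sub>j\<^sup>d\<close> of all those it meets sum to at most \<open>(4 s\<^sub>n)\<^sup>d\<close>, which is
  at most \<open>4\<^sup>d \<rho>\<^sup>d g(s\<^sub>n)/g(\<rho>)\<close>. The sets \<open>E\<^sub>n\<close> meeting a single shrunken ball spoil the
  invariant only for indices with \<open>\<Sum>g(r\<^sub>j\<^sup>t/2) \<le> g(\<rho>)\<close>, and since \<open>g(r\<^sub>j\<^sup>t/2)\<close> is of order
  \<open>r\<^sub>j\<^sup>d |log r\<^sub>j|\<close>, the logarithm makes their share of \<open>\<Sum>r\<^sub>j\<^sup>d\<close> negligible. So some shrunken ball
  inherits the invariant.
\<close>

section \<open>The gauge function\<close>

text \<open>The gauge of the theorem when \<open>a = d/t\<close>. Its value at 0 is 0, since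
  \<open>0 powr a = 0\<close>.\<close>

definition log_gauge :: "real \<Rightarrow> real \<Rightarrow> real" where
  "log_gauge a \<rho> = \<rho> powr a * \<bar>ln \<rho>\<bar>"

lemma log_gauge_nonneg: "0 \<le> log_gauge a \<rho>"
  by (simp add: log_gauge_def)

lemma log_gauge_pos: "0 < \<rho> \<Longrightarrow> \<rho> < 1 \<Longrightarrow> 0 < log_gauge a \<rho>"
  unfolding log_gauge_def by (intro mult_pos_pos) auto

lemma log_gauge_0 [simp]: "log_gauge a 0 = 0"
  by (simp add: log_gauge_def)

text \<open>The critical point of the gauge on (0,1) is \<open>exp (- 1 / a)\<close>. In the
  variables \<open>u = - ln \<rho>\<close> and \<open>v = - ln s\<close> the claim reads
  \<open>exp (- (a * v)) * v \<le> exp (- (a * u)) * u\<close>; it follows from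
  \<open>1 + y \<le> exp y\<close>, because \<open>a * u \<ge> 1\<close> in the given range.\<close>

lemma log_gauge_mono:
  assumes "0 < a" "0 < s" "s \<le> \<rho>" "\<rho> \<le> exp (- 1 / a)"
  shows "log_gauge a s \<le> log_gauge a \<rho>"
proof -
  define u where "u = - ln \<rho>"
  define v where "v = - ln s"
  have \<rho>: "0 < \<rho>" and uv: "u \<le> v" using assms by (auto simp: u_def v_def)
  have "ln \<rho> \<le> - 1 / a" using assms(4) \<rho> by (metis ln_exp ln_le_cancel_iff exp_gt_zero)
  then have au: "1 \<le> a * u" using \<open>0 < a\<close> by (simp add: u_def field_simps)
  then have u: "0 < u" using \<open>0 < a\<close> zero_less_mult_pos[of a u] by simp
  have "v \<le> u + (a * u) * (v - u)" using au uv mult_right_mono[of 1 "a * u" "v - u"] by simp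
  also have "\<dots> = u * (1 + a * (v - u))" by (simp add: algebra_simps)
  also have "\<dots> \<le> u * exp (a * (v - u))" using u by (intro mult_left_mono exp_ge_add_one_self) auto
  finally have "exp (- (a * v)) * v \<le> exp (- (a * v)) * (u * exp (a * (v - u)))"
    by (intro mult_left_mono) auto
  also have "\<dots> = exp (- (a * u)) * u"
    by (simp add: exp_diff exp_minus right_diff_distrib field_simps)
  finally show ?thesis
    using u uv assms \<rho> by (simp add: log_gauge_def powr_def u_def v_def)
qed

text \<open>Both factors of \<open>\<rho> powr (a - d) * \<bar>ln \<rho>\<bar>\<close> are
  nonincreasing on (0,1). This converts gauge into volume: \<open>s ^ d\<close> is at most
  \<open>\<rho> ^ d\<close> times the ratio of the gauges at \<open>s\<close> and
  \<open>\<rho>\<close>.\<close>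

lemma log_gauge_ratio:
  assumes "0 < s" "s \<le> \<rho>" "\<rho> < 1" "a \<le> real d"
  shows "log_gauge a \<rho> * s ^ d \<le> log_gauge a s * \<rho> ^ d"
proof -
  have \<rho>: "0 < \<rho>" using assms by simp
  have "\<rho> powr a * s ^ d = s ^ d * \<rho> ^ d * \<rho> powr (a - d)"
    using \<rho> by (simp add: powr_diff powr_realpow)
  also have "\<dots> \<le> s ^ d * \<rho> ^ d * s powr (a - d)"
    using assms by (intro mult_left_mono powr_mono2') auto
  also have "\<dots> = s powr a * \<rho> ^ d" using assms by (simp add: powr_diff powr_realpow)
  finally have 1: "\<rho> powr a * s ^ d \<le> s powr a * \<rho> ^ d" .
  have "ln s \<le> ln \<rho>" "ln \<rho> < 0" using assms \<rho> by auto
  then have "\<bar>ln \<rho>\<bar> \<le> \<bar>ln s\<bar>" by simp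
  with 1 have "(\<rho> powr a * s ^ d) * \<bar>ln \<rho>\<bar> \<le> (s powr a * \<rho> ^ d) * \<bar>ln s\<bar>"
    by (rule mult_mono) (use assms in auto)
  then show ?thesis by (simp add: log_gauge_def algebra_simps)
qed

lemma log_gauge_tendsto_0:
  assumes "0 < a"
  shows "(log_gauge a \<longlongrightarrow> 0) (at_right 0)"
  using assms unfolding log_gauge_def by real_asymp

text \<open>The power \<open>\<rho> powr (a - s)\<close> absorbs the logarithm near 0. This is how
  the gauge measure yields the dimension bound.\<close>

lemma log_gauge_le_powr:
  assumes "s < a"
  obtains \<delta> where "0 < \<delta>" "\<And>\<rho>. 0 \<le> \<rho> \<Longrightarrow> \<rho> \<le> \<delta> \<Longrightarrow> log_gauge a \<rho> \<le> \<rho> powr s"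
proof -
  have "(log_gauge (a - s) \<longlongrightarrow> 0) (at_right 0)" using assms by (intro log_gauge_tendsto_0) simp
  then have "eventually (\<lambda>\<rho>. log_gauge (a - s) \<rho> < 1) (at_right 0)"
    by (rule order_tendstoD) simp
  then obtain b where b: "0 < b" "\<And>y. 0 < y \<Longrightarrow> y < b \<Longrightarrow> log_gauge (a - s) y < 1"
    by (auto simp: eventually_at_right_field)
  show thesis
  proof (rule that)
    show "0 < b / 2" using b by simp
    fix \<rho> assume \<rho>: "0 \<le> \<rho>" "\<rho> \<le> b / 2"
    show "log_gauge a \<rho> \<le> \<rho> powr s"
    proof (cases "\<rho> = 0")
      case False
      then have "log_gauge (a - s) \<rho> \<le> 1" using b \<rho> by (intro less_imp_le b) auto
      then have "log_gauge (a - s) \<rho> * \<rho> powr s \<le> 1 * \<rho> powr s" by (intro mult_right_mono) auto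
      moreover have "log_gauge (a - s) \<rho> * \<rho> powr s = log_gauge a \<rho>"
        using False \<rho> by (simp add: log_gauge_def powr_diff)
      ultimately show ?thesis by simp
    qed simp
  qed
qed


section \<open>Balls of a norm\<close>

text \<open>\<open>N\<close> is an arbitrary norm, while topology and Lebesgue measure are those of
  the Euclidean structure. The balls of \<open>N\<close> therefore get their own names, and their
  topological properties come from comparing \<open>N\<close> with \<open>norm\<close>.\<close>

locale equivalent_norm =
  fixes N :: "'a::euclidean_space \<Rightarrow> real"
  assumes is_norm: "is_norm N"
begin

definition oball :: "'a \<Rightarrow> real \<Rightarrow> 'a set" where "oball z \<rho> = {y. N (y - z) < \<rho>}"
definition clball :: "'a \<Rightarrow> real \<Rightarrow> 'a set" where "clball z \<rho> = {y. N (y - z) \<le> \<rho>}"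

lemma nonneg [simp]: "0 \<le> N x"
  and eq_0_iff [simp]: "N x = 0 \<longleftrightarrow> x = 0"
  and scale: "N (c *\<^sub>R x) = \<bar>c\<bar> * N x"
  and triangle: "N (x + y) \<le> N x + N y"
  using is_norm unfolding is_norm_def by blast+

lemma zero [simp]: "N 0 = 0"
  by simp

lemma minus [simp]: "N (- x) = N x"
  using scale[of "-1" x] by simp

lemma commute: "N (x - y) = N (y - x)"
  using minus[of "x - y"] by simp

lemma triangle3: "N (x - z) \<le> N (x - y) + N (y - z)"
  using triangle[of "x - y" "y - z"] by simp

lemma upper_bound: obtains K where "0 < K" "\<And>x. N x \<le> K * norm x"
proof
  show "0 < (\<Sum>b\<in>Basis. N b) + 1" by (intro add_nonneg_pos sum_nonneg) auto
  fix x :: 'a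
  have sub: "N (sum f A) \<le> (\<Sum>b\<in>A. N (f b))" if "finite A" for f :: "'a \<Rightarrow> 'a" and A
    using that by induction (auto intro: order_trans[OF triangle])
  have "N x = N (\<Sum>b\<in>Basis. (x \<bullet> b) *\<^sub>R b)" by (simp add: euclidean_representation)
  also have "\<dots> \<le> (\<Sum>b\<in>Basis. N ((x \<bullet> b) *\<^sub>R b))" by (rule sub) simp
  also have "\<dots> \<le> (\<Sum>b\<in>Basis. norm x * N b)"
    by (intro sum_mono) (auto simp: scale Basis_le_norm intro!: mult_right_mono)
  also have "\<dots> \<le> ((\<Sum>b\<in>Basis. N b) + 1) * norm x"
    by (simp add: sum_distrib_left[symmetric] distrib_right)
  finally show "N x \<le> ((\<Sum>b\<in>Basis. N b) + 1) * norm x" .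
qed

lemma continuous_on_norm: "continuous_on S N"
proof -
  obtain K where K: "0 < K" "\<And>x. N x \<le> K * norm x" using upper_bound by blast
  have "\<bar>N x - N y\<bar> \<le> K * dist x y" for x y
    using triangle3[of x 0 y] triangle3[of y 0 x] K(2)[of "x - y"] commute[of x y]
    by (simp add: dist_norm abs_le_iff)
  then have "K-lipschitz_on S N" using K by (intro lipschitz_onI) (auto simp: dist_real_def)
  then show ?thesis by (rule lipschitz_on_continuous_on)
qed

lemma continuous_on_norm_diff: "continuous_on S (\<lambda>y. N (y - z))"
  by (intro continuous_on_compose2[OF continuous_on_norm[of UNIV]] continuous_intros) auto

text \<open>The constant is the minimum of \<open>N\<close> on the compact Euclidean unit
  sphere.\<close>

lemma lower_bound: obtains k where "0 < k" "\<And>x. k * norm x \<le> N x"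
proof -
  have "sphere (0::'a) 1 \<noteq> {}" by simp
  then obtain s where s: "s \<in> sphere 0 1" "\<And>y. y \<in> sphere 0 1 \<Longrightarrow> N s \<le> N y"
    using continuous_attains_inf[of "sphere (0::'a) 1" N] continuous_on_norm by auto
  show thesis
  proof (rule that[of "N s"])
    show "0 < N s" using s(1) nonneg[of s] eq_0_iff[of s] by (cases "s = 0") (auto simp: less_le)
    fix x :: 'a
    show "N s * norm x \<le> N x"
    proof (cases "x = 0")
      case False
      then have "N s \<le> N ((1 / norm x) *\<^sub>R x)" by (intro s(2)) simp
      with False show ?thesis by (simp add: scale field_simps)
    qed simp
  qed
qed

lemma open_oball: "open (oball z \<rho>)"
proof -
  have "open ((\<lambda>y. N (y - z)) -` {..<\<rho>})"
    by (rule open_vimage) (auto intro: continuous_on_norm_diff)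
  then show ?thesis by (simp add: oball_def vimage_def)
qed

lemma closed_clball: "closed (clball z \<rho>)"
proof -
  have "closed ((\<lambda>y. N (y - z)) -` {..\<rho>})"
    by (rule closed_vimage) (auto intro: continuous_on_norm_diff)
  then show ?thesis by (simp add: clball_def vimage_def)
qed

lemma bounded_clball: "bounded (clball z \<rho>)"
proof -
  obtain k where k: "0 < k" "\<And>x. k * norm x \<le> N x" using lower_bound by blast
  have "clball z \<rho> \<subseteq> cball z (\<rho> / k)"
  proof
    fix y assume "y \<in> clball z \<rho>"
    then have "k * norm (y - z) \<le> \<rho>" using k(2)[of "y - z"] by (simp add: clball_def)
    then show "y \<in> cball z (\<rho> / k)" using k(1) by (simp add: dist_norm norm_minus_commute field_simps)
  qed
  then show ?thesis using bounded_cball bounded_subset by blast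
qed

lemma compact_clball: "compact (clball z \<rho>)"
  using closed_clball bounded_clball by (simp add: compact_eq_bounded_closed)

lemma oball_subset_clball: "oball z \<rho> \<subseteq> clball z \<rho>"
  by (auto simp: oball_def clball_def)

lemma bounded_oball: "bounded (oball z \<rho>)"
  using bounded_subset[OF bounded_clball oball_subset_clball] .

lemma lmeasurable_oball [simp]: "oball z \<rho> \<in> lmeasurable"
  by (intro lmeasurable_open bounded_oball open_oball)

lemma open_contains_clball:
  assumes "open U" "z \<in> U"
  obtains e where "0 < e" "clball z e \<subseteq> U"
proof -
  obtain k where k: "0 < k" "\<And>x. k * norm x \<le> N x" using lower_bound by blast
  obtain e where e: "0 < e" "cball z e \<subseteq> U" using assms open_contains_cball by blast
  show thesis
  proof (rule that[of "k * e"])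
    show "0 < k * e" using k e by simp
    have "y \<in> cball z e" if "y \<in> clball z (k * e)" for y
    proof -
      have "k * norm (y - z) \<le> k * e" using that k(2)[of "y - z"] by (simp add: clball_def)
      then show ?thesis using k(1) by (simp add: dist_norm norm_minus_commute)
    qed
    then show "clball z (k * e) \<subseteq> U" using e by auto
  qed
qed

section \<open>Volumes and disjoint families of balls\<close>

definition unit_volume :: real where "unit_volume = measure lebesgue (oball 0 1)"

lemma measure_oball:
  assumes "0 < \<rho>"
  shows "measure lebesgue (oball z \<rho>) = unit_volume * \<rho> ^ DIM('a)"
proof -
  have "oball z \<rho> = (\<lambda>y. \<rho> *\<^sub>R y + z) ` oball 0 1"
  proof (intro set_eqI iffI)
    fix y assume "y \<in> oball z \<rho>"
    then have "(1 / \<rho>) *\<^sub>R (y - z) \<in> oball 0 1"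
      using assms by (simp add: oball_def scale)
    moreover have "y = \<rho> *\<^sub>R ((1 / \<rho>) *\<^sub>R (y - z)) + z" using assms by simp
    ultimately show "y \<in> (\<lambda>y. \<rho> *\<^sub>R y + z) ` oball 0 1" by (rule rev_image_eqI)
  qed (use assms in \<open>auto simp: oball_def scale\<close>)
  then show ?thesis
    using assms by (simp add: measure_lebesgue_affine unit_volume_def)
qed

lemma unit_volume_pos: "0 < unit_volume"
proof -
  have "0 \<in> oball 0 1" by (simp add: oball_def)
  then have "\<not> negligible (oball 0 1)" using open_not_negligible open_oball by blast
  then have "measure lebesgue (oball 0 1) \<noteq> 0" using negligible_iff_measure lmeasurable_oball by blast
  then show ?thesis unfolding unit_volume_def by (simp add: less_le)
qed

lemma sum_powers_le_of_disjoint_oballs: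
  assumes "finite J" "disjoint_family_on (\<lambda>j. oball (x j) (r j)) J" "\<And>j. j \<in> J \<Longrightarrow> 0 < r j"
    and "\<And>j. j \<in> J \<Longrightarrow> oball (x j) (r j) \<subseteq> oball z \<rho>" "0 < \<rho>"
  shows "(\<Sum>j\<in>J. r j ^ DIM('a)) \<le> \<rho> ^ DIM('a)"
proof -
  have "unit_volume * (\<Sum>j\<in>J. r j ^ DIM('a)) = (\<Sum>j\<in>J. measure lebesgue (oball (x j) (r j)))"
    by (simp add: sum_distrib_left assms measure_oball)
  also have "\<dots> = measure lebesgue (\<Union>j\<in>J. oball (x j) (r j))"
    using assms by (intro measure_UNION'[symmetric])
      (auto simp: pairwise_def disjnt_def disjoint_family_on_def)
  also have "\<dots> \<le> measure lebesgue (oball z \<rho>)"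
    using assms by (intro measure_mono_fmeasurable) (auto intro!: sets.finite_UN fmeasurableD)
  finally show ?thesis using unit_volume_pos assms by (simp add: measure_oball)
qed

text \<open>Greedy selection: a ball of largest radius is kept, every ball meeting it lies in its
  threefold enlargement, and the induction continues with the balls disjoint from it.\<close>

lemma finite_vitali:
  assumes "finite J" "\<And>j. j \<in> J \<Longrightarrow> 0 < r j"
  shows "\<exists>J'\<subseteq>J. disjoint_family_on (\<lambda>j. oball (x j) (r j)) J' \<and>
           (\<Union>j\<in>J. oball (x j) (r j)) \<subseteq> (\<Union>j\<in>J'. oball (x j) (3 * r j))"
  using assms
proof (induction "card J" arbitrary: J rule: less_induct)
  case less
  show ?case
  proof (cases "J = {}")
    case False
    have "Max (r ` J) \<in> r ` J" using less.prems False by (intro Max_in) auto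
    then obtain m where "m \<in> J" "r m = Max (r ` J)" by auto
    then have m: "m \<in> J" "\<And>j. j \<in> J \<Longrightarrow> r j \<le> r m" using less.prems by auto
    define J1 where "J1 = {j\<in>J. oball (x j) (r j) \<inter> oball (x m) (r m) = {}}"
    have "oball (x m) (r m) \<noteq> {}" using less.prems m by (auto simp: oball_def intro!: exI[of _ "x m"])
    then have "J1 \<subset> J" using m by (auto simp: J1_def)
    then have "card J1 < card J" "finite J1" using less.prems
      by (auto intro: psubset_card_mono finite_subset)
    moreover have "\<And>j. j \<in> J1 \<Longrightarrow> 0 < r j" using less.prems \<open>J1 \<subset> J\<close> by auto
    ultimately have "\<exists>J'\<subseteq>J1. disjoint_family_on (\<lambda>j. oball (x j) (r j)) J' \<and>
        (\<Union>j\<in>J1. oball (x j) (r j)) \<subseteq> (\<Union>j\<in>J'. oball (x j) (3 * r j))"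
      by (rule less.hyps)
    then obtain J' where J': "J' \<subseteq> J1" "disjoint_family_on (\<lambda>j. oball (x j) (r j)) J'"
      "(\<Union>j\<in>J1. oball (x j) (r j)) \<subseteq> (\<Union>j\<in>J'. oball (x j) (3 * r j))"
      by blast
    have "oball (x j) (r j) \<subseteq> oball (x m) (3 * r m)" if j: "j \<in> J" "j \<notin> J1" for j
    proof
      fix y assume y: "y \<in> oball (x j) (r j)"
      obtain q where q: "q \<in> oball (x j) (r j)" "q \<in> oball (x m) (r m)"
        using j by (auto simp: J1_def)
      have "N (y - x m) \<le> N (y - x j) + (N (x j - q) + N (q - x m))"
        using triangle3[of y "x m" "x j"] triangle3[of "x j" "x m" q] by simp
      then show "y \<in> oball (x m) (3 * r m)"
        using y q m(2)[OF j(1)] commute[of "x j" q] by (simp add: oball_def)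
    qed
    then have "(\<Union>j\<in>J. oball (x j) (r j)) \<subseteq> (\<Union>j\<in>insert m J'. oball (x j) (3 * r j))"
      using J'(3) by blast
    moreover have "disjoint_family_on (\<lambda>j. oball (x j) (r j)) (insert m J')"
      using J' by (auto simp: disjoint_family_on_def J1_def)
    moreover have "insert m J' \<subseteq> J" using m J' by (auto simp: J1_def)
    ultimately show ?thesis by blast
  qed (auto simp: disjoint_family_on_def)
qed


section \<open>Packing by small balls of the system\<close>

text \<open>Almost every point of the ball of radius \<open>\<rho> / 2\<close> lies in arbitrarily
  small balls of the system. Finitely many of these fill half of its volume, and a disjoint
  subfamily is selected by \<open>finite_vitali\<close>. The constant collects 2 for half the
  volume, \<open>2 ^ d\<close> for half the radius and \<open>3 ^ d\<close> for the enlargement,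
  where \<open>d = DIM('a)\<close>.\<close>

lemma ubiquitous_packing:
  fixes I :: "'i set"
  assumes hu: "homogeneous_ubiquitous N I x r U"
    and sub: "clball z \<rho> \<subseteq> U" and \<rho>: "0 < \<rho>" and \<eta>: "0 < \<eta>"
  obtains J where "finite J" "J \<subseteq> I" "disjoint_family_on (\<lambda>j. oball (x j) (r j)) J"
    "\<And>j. j \<in> J \<Longrightarrow> 0 < r j \<and> r j \<le> \<eta> \<and> oball (x j) (r j) \<subseteq> clball z \<rho>"
    "\<rho> ^ DIM('a) \<le> 2 * 6 ^ DIM('a) * (\<Sum>j\<in>J. r j ^ DIM('a))"
proof -
  define F where "F = F_set N I x r 1"
  \<comment> \<open>A ball of radius at most \<open>\<rho> / 4\<close> that meets
    \<open>oball z (\<rho> / 2)\<close> stays within distance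
    \<open>\<rho> / 2 + 2 * (\<rho> / 4) = \<rho>\<close> of \<open>z\<close>.\<close>
  define \<eta>' where "\<eta>' = min \<eta> (\<rho> / 4)"
  define I' where "I' = {i\<in>I. r i \<le> \<eta>' \<and> oball (x i) (r i) \<inter> oball z (\<rho> / 2) \<noteq> {}}"
  have sys: "countable I" "\<And>i. i \<in> I \<Longrightarrow> 0 < r i" "bdd_above (r ` I)"
    "\<And>m::nat. finite {i\<in>I. N (x i) < real m \<and> r i > 1 / real m}"
    and null: "U - F \<in> null_sets lebesgue"
    using hu by (auto simp: homogeneous_ubiquitous_def approximation_system_def F_def)
  obtain R where R: "\<And>i. i \<in> I \<Longrightarrow> r i \<le> R" using sys(3) by (auto simp: bdd_above_def)
  have "0 < \<eta>'" using \<rho> \<eta> by (simp add: \<eta>'_def)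
  have cover: "\<exists>i\<in>I'. y \<in> oball (x i) (r i)" if y: "y \<in> oball z (\<rho> / 2)" "y \<in> F" for y
  proof -
    \<comment> \<open>With this \<open>m\<close>, a ball through \<open>y\<close> of radius above
      \<open>\<eta>'\<close> has a centre of norm below \<open>m\<close> and radius above
      \<open>1 / m\<close>. The system has only finitely many such indices; discarding them leaves a
      small ball through \<open>y\<close>.\<close>
    obtain m :: nat where m: "max (N y + R) (max 1 (1 / \<eta>')) < real m" using reals_Archimedean2 by blast
    then have m': "1 / real m \<le> \<eta>'" using \<open>0 < \<eta>'\<close> by (auto simp: field_simps)
    have "infinite {i\<in>I. N (y - x i) < r i powr 1}" using y by (simp add: F_def F_set_def)
    then have "infinite ({i\<in>I. N (y - x i) < r i powr 1} - {i\<in>I. N (x i) < real m \<and> r i > 1 / real m})"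
      by (rule Diff_infinite_finite[OF sys(4)])
    then obtain i where i: "i \<in> I" "N (y - x i) < r i powr 1" "\<not> (N (x i) < real m \<and> r i > 1 / real m)"
      using infinite_imp_nonempty by blast
    then have i2: "N (y - x i) < r i" using sys(2)[OF i(1)] by simp
    have "N (x i) \<le> N (x i - y) + N y" using triangle3[of "x i" 0 y] by simp
    then have "N (x i) < real m" using i2 R[OF i(1)] m commute[of y "x i"] by simp
    then have "r i \<le> \<eta>'" using i m' by simp
    then show ?thesis using i i2 y by (auto simp: I'_def oball_def)
  qed
  define T where "T = (\<Union>i\<in>I'. oball (x i) (r i))"
  define v where "v = measure lebesgue (oball z (\<rho> / 2))"
  have v: "v = unit_volume * (\<rho> / 2) ^ DIM('a)" using \<rho> by (simp add: v_def measure_oball)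
  then have "0 < v" using \<rho> unit_volume_pos by simp
  have "open T" unfolding T_def using open_oball by blast
  then have T: "T \<in> sets lebesgue" by (intro sets_completionI_sets) simp
  have "oball z (\<rho> / 2) \<subseteq> U"
    using sub \<rho> by (auto simp: oball_def clball_def intro!: subsetD[OF sub])
  then have "oball z (\<rho> / 2) \<subseteq> T \<union> (U - F)" using cover by (auto simp: T_def)
  then have "emeasure lebesgue (oball z (\<rho> / 2)) \<le> emeasure lebesgue (T \<union> (U - F))"
    using T null by (intro emeasure_mono) auto
  also have "\<dots> = emeasure lebesgue T" using T null by (rule emeasure_Un_null_set)
  finally have vT: "ennreal v \<le> emeasure lebesgue T" by (simp add: v_def emeasure_eq_measure2)
  then have "T \<noteq> {}" using \<open>0 < v\<close> by auto
  then have "I' \<noteq> {}" by (auto simp: T_def)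
  have "countable I'" using sys(1) by (auto simp: I'_def)
  \<comment> \<open>Finite unions exhausting \<open>T\<close>: by continuity of measure from below,
    one of them has measure above \<open>v / 2\<close>.\<close>
  define A where "A n = (\<Union>j\<in>from_nat_into I' ` {..n}. oball (x j) (r j))" for n
  have A: "A n \<in> lmeasurable" for n unfolding A_def by (intro fmeasurable.finite_UN) auto
  have "incseq A" unfolding incseq_def A_def by (intro allI impI UN_mono image_mono) auto
  with A have "(SUP n. emeasure lebesgue (A n)) = emeasure lebesgue (\<Union>n. A n)"
    by (intro SUP_emeasure_incseq) (auto simp: fmeasurableD)
  also have "(\<Union>n. A n) = T"
  proof -
    have "(\<Union>n. A n) = (\<Union>j\<in>range (from_nat_into I'). oball (x j) (r j))"
      by (auto simp: A_def)
    also have "range (from_nat_into I') = I'"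
      using \<open>I' \<noteq> {}\<close> \<open>countable I'\<close> by (rule range_from_nat_into)
    finally show ?thesis by (simp add: T_def)
  qed
  finally have "ennreal (v / 2) < (SUP n. emeasure lebesgue (A n))"
    using vT \<open>0 < v\<close> by (simp add: less_le_trans[of _ "ennreal v"] ennreal_less_iff)
  then obtain n where n: "ennreal (v / 2) < emeasure lebesgue (A n)" by (auto simp: less_SUP_iff)
  define J0 where "J0 = from_nat_into I' ` {..n}"
  have J0: "finite J0" "J0 \<subseteq> I'" using from_nat_into[OF \<open>I' \<noteq> {}\<close>] by (auto simp: J0_def)
  then have "\<And>j. j \<in> J0 \<Longrightarrow> 0 < r j" using sys(2) by (auto simp: I'_def)
  then obtain J where J: "J \<subseteq> J0" "disjoint_family_on (\<lambda>j. oball (x j) (r j)) J"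
    "A n \<subseteq> (\<Union>j\<in>J. oball (x j) (3 * r j))"
    using finite_vitali[OF J0(1), of r x] unfolding A_def J0_def by auto
  have fin: "finite J" using J J0 by (auto intro: finite_subset)
  have rpos: "0 < r j" if "j \<in> J" for j using that J J0 sys(2) by (auto simp: I'_def)
  have "v / 2 \<le> measure lebesgue (A n)"
    using n A[of n] by (simp add: emeasure_eq_measure2 ennreal_less_iff \<open>0 < v\<close> less_imp_le)
  also have "\<dots> \<le> measure lebesgue (\<Union>j\<in>J. oball (x j) (3 * r j))"
    using J A fin by (intro measure_mono_fmeasurable fmeasurable.finite_UN) (auto simp: fmeasurableD)
  also have "\<dots> \<le> (\<Sum>j\<in>J. measure lebesgue (oball (x j) (3 * r j)))"
    using fin by (intro measure_UNION_le) (auto simp: fmeasurableD)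
  also have "\<dots> = unit_volume * (3 ^ DIM('a) * (\<Sum>j\<in>J. r j ^ DIM('a)))"
    by (simp add: rpos measure_oball sum_distrib_left power_mult_distrib)
  finally have "unit_volume * ((\<rho> / 2) ^ DIM('a) / 2) \<le> unit_volume * (3 ^ DIM('a) * (\<Sum>j\<in>J. r j ^ DIM('a)))"
    by (simp add: v)
  then have "(\<rho> / 2) ^ DIM('a) / 2 \<le> 3 ^ DIM('a) * (\<Sum>j\<in>J. r j ^ DIM('a))"
    using unit_volume_pos by simp
  then have "\<rho> ^ DIM('a) \<le> 2 * (2 ^ DIM('a) * 3 ^ DIM('a)) * (\<Sum>j\<in>J. r j ^ DIM('a))"
    by (simp add: power_divide field_simps)
  then have vol: "\<rho> ^ DIM('a) \<le> 2 * 6 ^ DIM('a) * (\<Sum>j\<in>J. r j ^ DIM('a))"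
    by (simp add: power_mult_distrib[symmetric])
  have "oball (x j) (r j) \<subseteq> clball z \<rho>" if j: "j \<in> J" for j
  proof
    fix y assume y: "y \<in> oball (x j) (r j)"
    have "j \<in> I'" using j J J0 by auto
    then obtain q where q: "r j \<le> \<rho> / 4" "q \<in> oball (x j) (r j)" "q \<in> oball z (\<rho> / 2)"
      by (auto simp: I'_def \<eta>'_def)
    have "N (y - z) \<le> N (y - x j) + (N (x j - q) + N (q - z))"
      using triangle3[of y z "x j"] triangle3[of "x j" z q] by simp
    then show "y \<in> clball z \<rho>"
      using q y commute[of "x j" q] by (simp add: oball_def clball_def)
  qed
  moreover have "r j \<le> \<eta>" "j \<in> I" if "j \<in> J" for j using that J J0 by (auto simp: I'_def \<eta>'_def)
  ultimately show thesis using that[OF fin _ J(2) _ vol] rpos by blast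
qed

text \<open>Let \<open>E\<close> meet the shrunken balls of \<open>j\<close> and of some
  \<open>k \<noteq> j\<close>. Its point near \<open>x k\<close> lies outside
  \<open>oball (x j) (r j)\<close>, its point near \<open>x j\<close> is within
  \<open>r j / 2\<close> of \<open>x j\<close>, so \<open>r j \<le> 2 * s\<close>. Hence each such
  ball lies within \<open>2 * s + s + s\<close> of a fixed point of \<open>E\<close>, and volumes
  are compared.\<close>

lemma sum_powers_le_of_hit_twice:
  assumes fin: "finite J" and disj: "disjoint_family_on (\<lambda>j. oball (x j) (r j)) J"
    and r: "\<And>j. j \<in> J \<Longrightarrow> 0 < r j \<and> q j \<le> r j / 2"
    and diam: "\<And>y y'. y \<in> E \<Longrightarrow> y' \<in> E \<Longrightarrow> N (y - y') \<le> s" and s: "0 < s"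
    and two: "j1 \<in> J" "j2 \<in> J" "j1 \<noteq> j2" "E \<inter> clball (x j1) (q j1) \<noteq> {}" "E \<inter> clball (x j2) (q j2) \<noteq> {}"
  shows "(\<Sum>j | j \<in> J \<and> E \<inter> clball (x j) (q j) \<noteq> {}. r j ^ DIM('a)) \<le> (4 * s) ^ DIM('a)"
proof -
  obtain y0 where y0: "y0 \<in> E" using two by auto
  have "oball (x j) (r j) \<subseteq> oball y0 (4 * s)"
    if j: "j \<in> J" and hit: "E \<inter> clball (x j) (q j) \<noteq> {}" for j
  proof
    fix p assume p: "p \<in> oball (x j) (r j)"
    obtain y where y: "y \<in> E" "N (y - x j) \<le> q j" using hit by (auto simp: clball_def)
    \<comment> \<open>At least one of \<open>j1\<close> and \<open>j2\<close> differs from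
      \<open>j\<close>.\<close>
    obtain k where k: "k \<in> J" "k \<noteq> j" "E \<inter> clball (x k) (q k) \<noteq> {}" using two by blast
    then obtain y' where y': "y' \<in> E" "N (y' - x k) \<le> q k" by (auto simp: clball_def)
    have "y' \<in> oball (x k) (r k)" using y' r[OF k(1)] by (simp add: oball_def)
    then have "y' \<notin> oball (x j) (r j)" using disj j k by (auto simp: disjoint_family_on_def)
    then have "r j \<le> N (y' - y) + N (y - x j)" using triangle3[of y' "x j" y] by (simp add: oball_def)
    then have "r j \<le> 2 * s" using diam[OF y'(1) y(1)] y r[OF j] by simp
    moreover have "N (p - y0) \<le> N (p - x j) + (N (x j - y) + N (y - y0))"
      using triangle3[of p y0 "x j"] triangle3[of "x j" y0 y] by simp
    ultimately show "p \<in> oball y0 (4 * s)"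
      using p diam[OF y(1) y0] y r[OF j] commute[of "x j" y] by (simp add: oball_def)
  qed
  then show ?thesis
    using fin disj r s by (intro sum_powers_le_of_disjoint_oballs[of _ x _ y0])
      (auto simp: disjoint_family_on_def)
qed


section \<open>Avoiding a cover\<close>

text \<open>For nonnegative weights this bounds the total weight of the sets meeting
  \<open>B\<close>. Stated with finite sums, it raises no question of summability, and its failure
  supplies a finite witness.\<close>

definition hit_weight_le :: "(nat \<Rightarrow> 'a set) \<Rightarrow> (nat \<Rightarrow> real) \<Rightarrow> 'a set \<Rightarrow> real \<Rightarrow> bool" where
  "hit_weight_le E w B \<kappa> \<longleftrightarrow> (\<forall>A. finite A \<longrightarrow> (\<forall>n\<in>A. E n \<inter> B \<noteq> {}) \<longrightarrow> sum w A \<le> \<kappa>)"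

text \<open>If every shrunken ball failed, each would have a finite witness \<open>A j\<close> of
  excess weight. The indices whose witnesses also hit another shrunken ball, and the remaining ones,
  would each contribute at most \<open>\<rho> ^ d / (6 * 6 ^ d)\<close> to the sum of
  \<open>r j ^ d\<close>, less in total than the packing guarantees.\<close>

lemma refinement_step:
  fixes I :: "'i set" and s :: "nat \<Rightarrow> real"
  assumes hu: "homogeneous_ubiquitous N I x r U" and t: "t > 1"
    and a_def: "a = real DIM('a) / t" and c_def: "c = 1 / (6 * 24 ^ DIM('a))"
    and s: "\<And>n. 0 < s n"
    and diam: "\<And>n y y'. y \<in> E n \<Longrightarrow> y' \<in> E n \<Longrightarrow> N (y - y') \<le> s n"
    and s_le: "\<And>n. s n \<le> exp (- 1 / a)"
    and \<rho>: "0 < \<rho>" "\<rho> \<le> exp (- 1 / a)" and sub: "clball z \<rho> \<subseteq> U"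
    and hit: "hit_weight_le E (\<lambda>n. log_gauge a (s n)) (clball z \<rho>) (c * log_gauge a \<rho>)"
  obtains j where "j \<in> I" "0 < r j powr t / 2" "r j powr t / 2 \<le> \<rho> / 2"
    "clball (x j) (r j powr t / 2) \<subseteq> clball z \<rho>"
    "hit_weight_le E (\<lambda>n. log_gauge a (s n)) (clball (x j) (r j powr t / 2))
       (c * log_gauge a (r j powr t / 2))"
proof -
  define d where "d = DIM('a)"
  define g where "g = log_gauge a"
  define q where "q j = r j powr t / 2" for j
  have a: "0 < a" "a \<le> real d"
    using t DIM_positive[where 'a='a] by (auto simp: a_def d_def field_simps)
  have c: "0 < c" "c < 1"
    using one_le_power[of "24::real" "DIM('a)"] by (auto simp: c_def simp del: one_le_power)
  have "exp (- 1 / a) < 1" using a by simp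
  then have "\<rho> < 1" using \<rho>(2) by (rule le_less_trans[rotated])
  then have g\<rho>: "0 < g \<rho>" using \<rho> by (simp add: g_def log_gauge_pos)
  \<comment> \<open>A lower bound for \<open>\<bar>ln (q j)\<bar>\<close>, enforced by
    \<open>\<eta> \<le> exp (- M)\<close>. It solves
    \<open>2 powr a * g \<rho> = M * (\<rho> ^ d / (6 * 6 ^ d))\<close>, as the estimate
    \<open>sum2\<close> requires.\<close>
  define M where "M = 2 powr a * g \<rho> * (6 * 6 ^ d) / \<rho> ^ d"
  have M: "0 < M" using g\<rho> \<rho> by (simp add: M_def)
  define \<eta> where "\<eta> = min (exp (- M)) (\<rho> / 2)"
  have \<eta>: "0 < \<eta>" "\<eta> \<le> exp (- M)" "\<eta> \<le> \<rho> / 2" using \<rho> by (auto simp: \<eta>_def)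
  obtain J where J: "finite J" "J \<subseteq> I" "disjoint_family_on (\<lambda>j. oball (x j) (r j)) J"
    and r_oball: "\<And>j. j \<in> J \<Longrightarrow> 0 < r j \<and> r j \<le> \<eta> \<and> oball (x j) (r j) \<subseteq> clball z \<rho>"
    and vol: "\<rho> ^ d \<le> 2 * 6 ^ d * (\<Sum>j\<in>J. r j ^ d)"
    using ubiquitous_packing[OF hu sub \<rho>(1) \<eta>(1)] unfolding d_def by blast
  have r: "0 < r j" "r j \<le> exp (- M)" "r j \<le> \<rho> / 2" "r j < 1" if "j \<in> J" for j
    using r_oball[OF that] \<eta> \<open>\<rho> < 1\<close> by auto
  have q: "0 < q j" "q j \<le> r j / 2" if "j \<in> J" for j
  proof -
    have "r j powr t \<le> r j powr 1" using r[OF that] t by (intro powr_mono') auto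
    then show "0 < q j" "q j \<le> r j / 2" using r[OF that] by (auto simp: q_def)
  qed
  have B_sub: "clball (x j) (q j) \<subseteq> clball z \<rho>" if "j \<in> J" for j
    using r_oball[OF that] q[OF that] by (force simp: clball_def oball_def)
  \<comment> \<open>Since \<open>t * a = d\<close>, the power \<open>q j powr a\<close> is
    \<open>r j ^ d\<close> up to the factor \<open>2 powr a\<close>; the logarithm contributes
    \<open>M\<close>.\<close>
  have g_q: "r j ^ d * M \<le> 2 powr a * g (q j)" if "j \<in> J" for j
  proof -
    have rj: "0 < r j" "q j \<le> r j" "0 < q j" using r[OF that] q[OF that] by auto
    have "ln (q j) \<le> ln (exp (- M))" using rj r(2)[OF that] by (subst ln_le_cancel_iff) auto
    then have "M \<le> \<bar>ln (q j)\<bar>" by simp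
    moreover have "r j ^ d = 2 powr a * q j powr a"
    proof -
      have "2 powr a * q j powr a = (r j powr t) powr a"
        using rj by (simp add: powr_mult[symmetric] q_def)
      also have "\<dots> = r j powr (t * a)" by (rule powr_powr)
      also have "t * a = real d" using t by (simp add: a_def d_def)
      finally show ?thesis using rj by (simp add: powr_realpow)
    qed
    ultimately show ?thesis by (simp add: g_def log_gauge_def mult_left_mono)
  qed
  have "\<exists>j\<in>J. hit_weight_le E (\<lambda>n. g (s n)) (clball (x j) (q j)) (c * g (q j))"
  proof (rule ccontr)
    assume "\<not> ?thesis"
    then have "\<forall>j\<in>J. \<exists>A. finite A \<and> (\<forall>n\<in>A. E n \<inter> clball (x j) (q j) \<noteq> {}) \<and>
        c * g (q j) < (\<Sum>n\<in>A. g (s n))"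
      by (auto simp: hit_weight_le_def not_le)
    then obtain A where A: "\<And>j. j \<in> J \<Longrightarrow> finite (A j)"
      "\<And>j n. j \<in> J \<Longrightarrow> n \<in> A j \<Longrightarrow> E n \<inter> clball (x j) (q j) \<noteq> {}"
      "\<And>j. j \<in> J \<Longrightarrow> c * g (q j) < (\<Sum>n\<in>A j. g (s n))"
      by metis
    define AA where "AA = (\<Union>j\<in>J. A j)"
    define H where "H n = {j\<in>J. E n \<inter> clball (x j) (q j) \<noteq> {}}" for n
    define J1 where "J1 = {j\<in>J. \<exists>n\<in>A j. \<exists>k\<in>J. k \<noteq> j \<and> k \<in> H n}"
    have AA: "finite AA" using A J by (auto simp: AA_def)
    have "\<forall>n\<in>AA. E n \<inter> clball z \<rho> \<noteq> {}" using A(2) B_sub by (fastforce simp: AA_def)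
    with AA hit have w_AA: "(\<Sum>n\<in>AA. g (s n)) \<le> c * g \<rho>"
      unfolding hit_weight_le_def g_def by blast
    have g_nonneg: "0 \<le> g y" for y by (simp add: g_def log_gauge_nonneg)
    \<comment> \<open>A set of larger size would alone weigh at least \<open>g \<rho>\<close>, more
      than the allowed \<open>c * g \<rho>\<close>.\<close>
    have s_\<rho>: "s n \<le> \<rho>" if "n \<in> AA" for n
    proof (rule ccontr)
      assume "\<not> s n \<le> \<rho>"
      then have "g \<rho> \<le> g (s n)" unfolding g_def using a \<rho> s_le by (intro log_gauge_mono) auto
      also have "\<dots> \<le> (\<Sum>n\<in>AA. g (s n))" using AA that by (intro member_le_sum) (auto simp: g_nonneg)
      also have "\<dots> \<le> c * g \<rho>" by (rule w_AA)
      finally show False using c g\<rho> by simp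
    qed
    have sum1: "(\<Sum>j\<in>J1. r j ^ d) \<le> 4 ^ d * c * \<rho> ^ d"
    proof -
      define D where "D = {n\<in>AA. \<exists>j\<in>H n. \<exists>k\<in>H n. j \<noteq> k}"
      have D: "finite D" "D \<subseteq> AA" using AA by (auto simp: D_def)
      have fin_H: "finite (H n)" for n using J by (auto simp: H_def)
      have J1_sub: "\<exists>n\<in>D. j \<in> H n" if "j \<in> J1" for j
        using that A(2) by (fastforce simp: J1_def D_def AA_def H_def)
      \<comment> \<open>Double counting: each index of \<open>J1\<close> occurs at least once on the
        right. After swapping the sums, the inner one runs over balls hit by a single set, which
        hits at least two.\<close>
      have "(\<Sum>j\<in>J1. r j ^ d) \<le> (\<Sum>j\<in>J1. \<Sum>n\<in>D. if j \<in> H n then r j ^ d else 0)"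
      proof (rule sum_mono)
        fix j assume j: "j \<in> J1"
        then obtain n where n: "n \<in> D" "j \<in> H n" using J1_sub by blast
        have "0 \<le> r j" using j r(1) by (force simp: J1_def)
        then have "(if j \<in> H n then r j ^ d else 0) \<le> (\<Sum>n\<in>D. if j \<in> H n then r j ^ d else 0)"
          using D n by (intro member_le_sum) auto
        then show "r j ^ d \<le> (\<Sum>n\<in>D. if j \<in> H n then r j ^ d else 0)" using n by simp
      qed
      also have "\<dots> = (\<Sum>n\<in>D. \<Sum>j\<in>J1. if j \<in> H n then r j ^ d else 0)" by (rule sum.swap)
      also have "\<dots> \<le> (\<Sum>n\<in>D. (4 * s n) ^ d)"
      proof (rule sum_mono)
        fix n assume n: "n \<in> D"
        have "(\<Sum>j\<in>J1. if j \<in> H n then r j ^ d else 0) = (\<Sum>j\<in>J1 \<inter> H n. r j ^ d)"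
          using J by (subst sum.inter_restrict) (auto simp: J1_def)
        also have "\<dots> \<le> (\<Sum>j\<in>H n. r j ^ d)"
          using fin_H r(1) by (intro sum_mono2) (auto simp: H_def less_imp_le)
        also have "\<dots> \<le> (4 * s n) ^ d"
        proof -
          obtain j k where "j \<in> H n" "k \<in> H n" "j \<noteq> k" using n by (auto simp: D_def)
          then show ?thesis unfolding H_def d_def
            using J q r s diam by (intro sum_powers_le_of_hit_twice[of _ _ _ _ _ _ j k]) auto
        qed
        finally show "(\<Sum>j\<in>J1. if j \<in> H n then r j ^ d else 0) \<le> (4 * s n) ^ d" .
      qed
      also have "\<dots> \<le> (\<Sum>n\<in>AA. (4 * s n) ^ d)"
        using AA D s by (intro sum_mono2) (auto simp: less_imp_le)
      also have "\<dots> \<le> (\<Sum>n\<in>AA. 4 ^ d * \<rho> ^ d / g \<rho> * g (s n))"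
      proof (rule sum_mono)
        fix n assume "n \<in> AA"
        then have "g \<rho> * s n ^ d \<le> g (s n) * \<rho> ^ d"
          unfolding g_def using a s s_\<rho> \<open>\<rho> < 1\<close> by (intro log_gauge_ratio) auto
        then have "s n ^ d \<le> g (s n) * \<rho> ^ d / g \<rho>" using g\<rho> by (simp add: field_simps)
        then have "4 ^ d * s n ^ d \<le> 4 ^ d * (g (s n) * \<rho> ^ d / g \<rho>)"
          by (rule mult_left_mono) simp
        then show "(4 * s n) ^ d \<le> 4 ^ d * \<rho> ^ d / g \<rho> * g (s n)"
          by (simp add: power_mult_distrib mult.commute mult.left_commute)
      qed
      also have "\<dots> = 4 ^ d * \<rho> ^ d / g \<rho> * (\<Sum>n\<in>AA. g (s n))" by (simp add: sum_distrib_left)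
      also have "\<dots> \<le> 4 ^ d * \<rho> ^ d / g \<rho> * (c * g \<rho>)"
        using \<rho> g\<rho> by (intro mult_left_mono w_AA) auto
      also have "\<dots> = 4 ^ d * c * \<rho> ^ d" using g\<rho> by simp
      finally show ?thesis .
    qed
    have sum2: "(\<Sum>j\<in>J - J1. r j ^ d) \<le> \<rho> ^ d / (6 * 6 ^ d)"
    proof -
      have "c * (\<Sum>j\<in>J - J1. g (q j)) \<le> (\<Sum>j\<in>J - J1. \<Sum>n\<in>A j. g (s n))"
        unfolding sum_distrib_left using A(3) by (intro sum_mono) (auto simp: less_imp_le)
      also have "\<dots> = (\<Sum>n\<in>(\<Union>j\<in>J - J1. A j). g (s n))"
      proof (rule sum.UNION_disjoint[symmetric])
        \<comment> \<open>A common element of two witnesses would hit both balls and put both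
          indices into \<open>J1\<close>.\<close>
        show "\<forall>i\<in>J - J1. \<forall>j\<in>J - J1. i \<noteq> j \<longrightarrow> A i \<inter> A j = {}"
          using A(2) by (fastforce simp: J1_def H_def)
      qed (use J A in auto)
      also have "\<dots> \<le> (\<Sum>n\<in>AA. g (s n))"
        using AA by (intro sum_mono2) (auto simp: AA_def g_nonneg)
      also have "\<dots> \<le> c * g \<rho>" by (rule w_AA)
      finally have *: "(\<Sum>j\<in>J - J1. g (q j)) \<le> g \<rho>" using c by simp
      have "M * (\<Sum>j\<in>J - J1. r j ^ d) \<le> (\<Sum>j\<in>J - J1. 2 powr a * g (q j))"
        unfolding sum_distrib_left using g_q by (intro sum_mono) (auto simp: mult.commute)
      also have "\<dots> = 2 powr a * (\<Sum>j\<in>J - J1. g (q j))" by (simp add: sum_distrib_left)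
      also have "\<dots> \<le> 2 powr a * g \<rho>" using * by simp
      also have "\<dots> = M * (\<rho> ^ d / (6 * 6 ^ d))" using \<rho> by (simp add: M_def)
      finally show ?thesis using M by (rule mult_left_le_imp_le)
    qed
    \<comment> \<open>The 24 in \<open>c\<close> is 4 * 6: it cancels the \<open>4 ^ d\<close> of
      \<open>sum1\<close> and leaves the same bound as in \<open>sum2\<close>.\<close>
    have "4 ^ d * c = 1 / (6 * 6 ^ d)"
      using power_mult_distrib[of "4::real" 6 d] by (simp add: c_def d_def)
    then have "4 ^ d * c * \<rho> ^ d = \<rho> ^ d / (6 * 6 ^ d)" by simp
    moreover have "(\<Sum>j\<in>J. r j ^ d) = (\<Sum>j\<in>J - J1. r j ^ d) + (\<Sum>j\<in>J1. r j ^ d)"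
      using J by (intro sum.subset_diff) (auto simp: J1_def)
    ultimately have "(\<Sum>j\<in>J. r j ^ d) \<le> 2 * (\<rho> ^ d / (6 * 6 ^ d))" using sum1 sum2 by simp
    then have "2 * 6 ^ d * (\<Sum>j\<in>J. r j ^ d) \<le> 2 * 6 ^ d * (2 * (\<rho> ^ d / (6 * 6 ^ d)))"
      by (intro mult_left_mono) auto
    also have "\<dots> = 2 / 3 * \<rho> ^ d" by simp
    also have "\<dots> < \<rho> ^ d" using \<rho> by simp
    finally show False using vol by simp
  qed
  then obtain j where j: "j \<in> J"
    "hit_weight_le E (\<lambda>n. g (s n)) (clball (x j) (q j)) (c * g (q j))" by blast
  show thesis
    using that[of j] j J q[OF j(1)] r[OF j(1)] B_sub[OF j(1)] \<rho> by (auto simp: q_def g_def)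
qed

text \<open>Iterated refinement gives nested compact balls with a common point \<open>y\<close>. If
  \<open>y\<close> were in \<open>E n\<close>, this set would meet every ball; once the radius
  \<open>P k\<close> is below \<open>s n\<close>, its weight would be at most \<open>c\<close> times
  the gauge at \<open>P k\<close>, against monotonicity.\<close>

lemma exists_uncovered:
  fixes I :: "'i set" and s :: "nat \<Rightarrow> real"
  assumes hu: "homogeneous_ubiquitous N I x r U" and t: "t > 1"
    and a_def: "a = real DIM('a) / t" and c_def: "c = 1 / (6 * 24 ^ DIM('a))"
    and s: "\<And>n. 0 < s n"
    and diam: "\<And>n y y'. y \<in> E n \<Longrightarrow> y' \<in> E n \<Longrightarrow> N (y - y') \<le> s n"
    and s_le: "\<And>n. s n \<le> exp (- 1 / a)"
    and \<rho>: "0 < \<rho>" "\<rho> \<le> exp (- 1 / a)" and sub: "clball z \<rho> \<subseteq> U"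
    and hit: "hit_weight_le E (\<lambda>n. log_gauge a (s n)) (clball z \<rho>) (c * log_gauge a \<rho>)"
  shows "\<exists>y\<in>F_set N I x r t \<inter> U. \<forall>n. y \<notin> E n"
proof -
  have a: "0 < a" using t DIM_positive[where 'a='a] by (simp add: a_def)
  have c: "0 < c" "c < 1"
    using one_le_power[of "24::real" "DIM('a)"] by (auto simp: c_def simp del: one_le_power)
  define admissible where "admissible = (\<lambda>(z, \<rho>). 0 < \<rho> \<and> \<rho> \<le> exp (- 1 / a) \<and> clball z \<rho> \<subseteq> U \<and>
      hit_weight_le E (\<lambda>n. log_gauge a (s n)) (clball z \<rho>) (c * log_gauge a \<rho>))"
  \<comment> \<open>Only the new ball must come from the system, since the initial ball is
    arbitrary; hence the shift to \<open>Suc k\<close> for the indices \<open>j k\<close>.\<close>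
  define refines where "refines = (\<lambda>(z, \<rho>) (z', \<rho>'). \<rho>' \<le> \<rho> / 2 \<and> clball z' \<rho>' \<subseteq> clball z \<rho> \<and>
      (\<exists>j\<in>I. z' = x j \<and> \<rho>' = r j powr t / 2))"
  have "\<exists>f. \<forall>k. admissible (f k) \<and> refines (f k) (f (Suc k))"
  proof (rule dependent_nat_choice)
    show "\<exists>p. admissible p" using \<rho> sub hit by (auto simp: admissible_def)
    fix p and k :: nat assume p: "admissible p"
    obtain z \<rho> where p_eq: "p = (z, \<rho>)" by (cases p)
    have adm: "0 < \<rho>" "\<rho> \<le> exp (- 1 / a)" "clball z \<rho> \<subseteq> U"
      "hit_weight_le E (\<lambda>n. log_gauge a (s n)) (clball z \<rho>) (c * log_gauge a \<rho>)"
      using p by (auto simp: p_eq admissible_def)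
    obtain j where j: "j \<in> I" "0 < r j powr t / 2" "r j powr t / 2 \<le> \<rho> / 2"
      "clball (x j) (r j powr t / 2) \<subseteq> clball z \<rho>"
      "hit_weight_le E (\<lambda>n. log_gauge a (s n)) (clball (x j) (r j powr t / 2))
         (c * log_gauge a (r j powr t / 2))"
      using refinement_step[OF hu t a_def c_def s diam s_le adm] .
    have "r j powr t / 2 \<le> exp (- 1 / a)" using j(3) adm by linarith
    then have "admissible (x j, r j powr t / 2) \<and> refines p (x j, r j powr t / 2)"
      using j adm unfolding p_eq admissible_def refines_def by auto
    then show "\<exists>p'. admissible p' \<and> refines p p'" by blast
  qed
  then obtain f where f: "\<And>k. admissible (f k)" "\<And>k. refines (f k) (f (Suc k))" by blast
  define Z where "Z k = fst (f k)" for k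
  define P where "P k = snd (f k)" for k
  have f_eq: "f k = (Z k, P k)" for k by (simp add: Z_def P_def)
  have P: "0 < P k" "P k \<le> exp (- 1 / a)" and ZP_sub: "clball (Z k) (P k) \<subseteq> U"
    and ZP_hit: "hit_weight_le E (\<lambda>n. log_gauge a (s n)) (clball (Z k) (P k)) (c * log_gauge a (P k))"
    for k using f(1)[of k] by (auto simp: f_eq admissible_def)
  have P_Suc: "P (Suc k) \<le> P k / 2" and ZP_Suc: "clball (Z (Suc k)) (P (Suc k)) \<subseteq> clball (Z k) (P k)"
    and ex_j: "\<exists>j\<in>I. Z (Suc k) = x j \<and> P (Suc k) = r j powr t / 2" for k
    using f(2)[of k] by (auto simp: f_eq refines_def)
  obtain j where j: "\<And>k. j k \<in> I" "\<And>k. Z (Suc k) = x (j k)" "\<And>k. P (Suc k) = r (j k) powr t / 2"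
    using ex_j by metis
  have "(\<Inter>k. clball (Z k) (P k)) \<noteq> {}"
  proof (rule compact_nest)
    show "clball (Z k) (P k) \<noteq> {}" for k using P(1)[of k] by (auto simp: clball_def intro!: exI[of _ "Z k"])
    show "clball (Z n) (P n) \<subseteq> clball (Z m) (P m)" if "m \<le> n" for m n
      using ZP_Suc that by (rule lift_Suc_antimono_le)
  qed (rule compact_clball)
  then obtain y where y: "\<And>k. y \<in> clball (Z k) (P k)" by blast
  have "P k \<le> P 0 / 2 ^ k" for k
  proof (induction k)
    case (Suc k)
    then show ?case using P_Suc[of k] by simp
  qed simp
  moreover have "(\<lambda>k. P 0 / 2 ^ k) \<longlonglongrightarrow> 0" by real_asymp
  ultimately have P_lim: "P \<longlonglongrightarrow> 0"
    using P(1) by (intro real_tendsto_sandwich[of "\<lambda>_. 0" P _ "\<lambda>k. P 0 / 2 ^ k"]) (auto simp: less_imp_le)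
  have P_decr: "P l < P k" if "k < l" for k l
    using that
  proof (induction rule: less_Suc_induct)
    case (1 k)
    show ?case using P_Suc[of k] P(1)[of k] by linarith
  qed simp
  \<comment> \<open>The index \<open>j k\<close> determines the radius \<open>P (Suc k)\<close>, and
    the radii decrease strictly, so no index is repeated.\<close>
  have "inj j"
  proof (rule injI)
    fix k l assume "j k = j l"
    then have "P (Suc k) = P (Suc l)" by (simp add: j)
    then show "k = l" using P_decr[of "Suc k" "Suc l"] P_decr[of "Suc l" "Suc k"] by (cases k l rule: linorder_cases) auto
  qed
  then have "infinite (range j)" by (rule range_inj_infinite)
  moreover have "range j \<subseteq> {i\<in>I. N (y - x i) < r i powr t}"
  proof -
    have "N (y - x (j k)) < r (j k) powr t" for k
    proof -
      have "N (y - x (j k)) \<le> P (Suc k)" using y[of "Suc k"] by (simp add: j clball_def)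
      \<comment> \<open>The factor 1/2 in the radius turns the closed ball into the strict
        inequality.\<close>
      then show ?thesis using P(1)[of "Suc k"] j(3)[of k] by linarith
    qed
    then show ?thesis using j(1) by auto
  qed
  ultimately have "y \<in> F_set N I x r t" unfolding F_set_def using finite_subset by blast
  moreover have "y \<in> U" using y ZP_sub by blast
  moreover have "y \<notin> E n" for n
  proof
    assume yE: "y \<in> E n"
    have "eventually (\<lambda>k. P k < s n) sequentially" using P_lim s by (rule order_tendstoD)
    then obtain k where k: "P k < s n" by (auto simp: eventually_sequentially)
    have "(\<Sum>n\<in>{n}. log_gauge a (s n)) \<le> c * log_gauge a (P k)"
      using ZP_hit[of k] yE y[of k] unfolding hit_weight_le_def by blast
    also have "\<dots> < log_gauge a (P k)"
    proof -
      have "P k < 1" using P(2)[of k] a by (rule_tac le_less_trans[of _ "exp (- 1 / a)"]) auto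
      then show ?thesis using c log_gauge_pos[OF P(1)[of k]] by simp
    qed
    also have "\<dots> \<le> log_gauge a (s n)" using a P(1)[of k] k s_le by (intro log_gauge_mono) auto
    finally show False by simp
  qed
  ultimately show ?thesis by blast
qed


section \<open>Hausdorff measures\<close>

lemma dist_le_diamN:
  assumes "boundedN N C" "y \<in> C" "y' \<in> C"
  shows "N (y - y') \<le> diamN N C"
proof -
  have "N (y - y') \<le> Sup {N (a - b) |a b. a \<in> C \<and> b \<in> C}"
    using assms by (intro cSup_upper) (auto simp: boundedN_def)
  then show ?thesis using assms by (auto simp: diamN_def)
qed

lemma diamN_nonneg:
  assumes "boundedN N C"
  shows "0 \<le> diamN N C"
proof (cases "C = {}")
  case False
  then obtain y where "y \<in> C" by blast
  then show ?thesis using dist_le_diamN[OF assms, of y y] by simp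
qed (simp add: diamN_def)

text \<open>Contents grow as the scale shrinks, so it suffices to compare covers by sets of diameter
  at most \<open>\<delta>\<close>.\<close>

lemma hausdorff_g_mono:
  assumes "0 < \<delta>" "\<And>\<rho>. 0 \<le> \<rho> \<Longrightarrow> \<rho> \<le> \<delta> \<Longrightarrow> g \<rho> \<le> h \<rho>"
  shows "hausdorff_g N g E \<le> hausdorff_g N h E"
  unfolding hausdorff_g_def
proof (rule SUP_least)
  fix \<delta>' :: real assume "\<delta>' \<in> {0<..}"
  then have pos: "min \<delta> \<delta>' \<in> {0<..}" using assms(1) by simp
  have "hausdorff_content_g N g \<delta>' E \<le> hausdorff_content_g N g (min \<delta> \<delta>') E"
    unfolding hausdorff_content_g_def by (intro INF_superset_mono) auto
  also have "\<dots> \<le> hausdorff_content_g N h (min \<delta> \<delta>') E"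
    unfolding hausdorff_content_g_def
    by (rule INF_superset_mono[OF order_refl], rule suminf_le, rule ennreal_leI, rule assms(2))
      (auto simp: diamN_nonneg)
  also have "\<dots> \<le> (SUP \<delta>\<in>{0<..}. hausdorff_content_g N h \<delta> E)"
    using pos by (rule SUP_upper)
  finally show "hausdorff_content_g N g \<delta>' E \<le> (SUP \<delta>\<in>{0<..}. hausdorff_content_g N h \<delta> E)" .
qed

text \<open>The content at the single scale \<open>exp (- 1 / a)\<close> is already bounded below: a
  cover with total gauge below \<open>\<kappa>\<close> would satisfy the invariant on a ball inside
  \<open>U\<close> and so miss a point.\<close>

lemma hausdorff_g_log_gauge_pos:
  fixes I :: "'i set"
  assumes hu: "homogeneous_ubiquitous N I x r U" and t: "t > 1"
    and a_def: "a = real DIM('a) / t"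
  shows "0 < hausdorff_g N (log_gauge a) (F_set N I x r t \<inter> U)"
proof -
  define c :: real where "c = 1 / (6 * 24 ^ DIM('a))"
  define \<delta> where "\<delta> = exp (- 1 / a)"
  have a: "0 < a" using t DIM_positive[where 'a='a] by (simp add: a_def)
  then have \<delta>: "0 < \<delta>" "\<delta> < 1" by (auto simp: \<delta>_def)
  have "open U" "U \<noteq> {}" using hu by (auto simp: homogeneous_ubiquitous_def)
  then obtain z where "z \<in> U" by blast
  with \<open>open U\<close> obtain e where e: "0 < e" "clball z e \<subseteq> U" by (rule open_contains_clball)
  define \<rho> where "\<rho> = min e \<delta>"
  have \<rho>: "0 < \<rho>" "\<rho> \<le> exp (- 1 / a)" using e \<delta> by (auto simp: \<rho>_def \<delta>_def)
  have sub: "clball z \<rho> \<subseteq> U" using e by (auto simp: \<rho>_def clball_def)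
  \<comment> \<open>One \<open>\<kappa>\<close> is reserved for the cover itself and one for the
    sizes \<open>\<tau> n\<close>, whose gauges add up to at most \<open>\<kappa>\<close>.\<close>
  define \<kappa> where "\<kappa> = c * log_gauge a \<rho> / 2"
  have "0 < \<kappa>" using \<rho> \<delta> by (simp add: \<kappa>_def c_def log_gauge_pos \<rho>_def)
  have "ennreal \<kappa> \<le> hausdorff_content_g N (log_gauge a) \<delta> (F_set N I x r t \<inter> U)"
    unfolding hausdorff_content_g_def
  proof (rule INF_greatest, rule ccontr)
    fix C :: "nat \<Rightarrow> 'a set"
    assume "C \<in> {C. F_set N I x r t \<inter> U \<subseteq> (\<Union>n. C n) \<and> (\<forall>n. boundedN N (C n) \<and> diamN N (C n) \<le> \<delta>)}"
    then have C: "F_set N I x r t \<inter> U \<subseteq> (\<Union>n. C n)" "\<And>n. boundedN N (C n)" "\<And>n. diamN N (C n) \<le> \<delta>"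
      by auto
    assume "\<not> ennreal \<kappa> \<le> (\<Sum>n. ennreal (log_gauge a (diamN N (C n))))"
    then have small: "(\<Sum>n. ennreal (log_gauge a (diamN N (C n)))) \<le> ennreal \<kappa>" by simp
    have sum_diam: "(\<Sum>n\<in>A. log_gauge a (diamN N (C n))) \<le> \<kappa>" if "finite A" for A
    proof -
      have "ennreal (\<Sum>n\<in>A. log_gauge a (diamN N (C n))) = (\<Sum>n\<in>A. ennreal (log_gauge a (diamN N (C n))))"
        by (simp add: log_gauge_nonneg)
      also have "\<dots> \<le> (\<Sum>n. ennreal (log_gauge a (diamN N (C n))))"
        using that by (intro sum_le_suminf) auto
      also note small
      finally show ?thesis using \<open>0 < \<kappa>\<close> by simp
    qed
    have "\<exists>\<tau>>0. \<tau> \<le> \<delta> \<and> log_gauge a \<tau> \<le> \<kappa> * (1/2) ^ Suc n" for n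
    proof -
      have "eventually (\<lambda>\<tau>. log_gauge a \<tau> < \<kappa> * (1/2) ^ Suc n) (at_right 0)"
        using log_gauge_tendsto_0[OF a] by (rule order_tendstoD) (use \<open>0 < \<kappa>\<close> in simp)
      moreover have "eventually (\<lambda>\<tau>. \<tau> \<in> {0<..<\<delta>}) (at_right 0)"
        using \<delta>(1) by (rule eventually_at_right_real)
      ultimately have "eventually (\<lambda>\<tau>. 0 < \<tau> \<and> \<tau> \<le> \<delta> \<and> log_gauge a \<tau> \<le> \<kappa> * (1/2) ^ Suc n) (at_right 0)"
        by eventually_elim auto
      then show ?thesis using eventually_happens'[OF trivial_limit_at_right_real] by blast
    qed
    then obtain \<tau> where \<tau>: "\<And>n. 0 < \<tau> n" "\<And>n. \<tau> n \<le> \<delta>"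
      "\<And>n. log_gauge a (\<tau> n) \<le> \<kappa> * (1/2) ^ Suc n" by metis
    \<comment> \<open>The gauge vanishes at 0, so covering sets of diameter 0 are given a small positive size.\<close>
    define s where "s n = max (diamN N (C n)) (\<tau> n)" for n
    have hit: "hit_weight_le C (\<lambda>n. log_gauge a (s n)) (clball z \<rho>) (c * log_gauge a \<rho>)"
      unfolding hit_weight_le_def
    proof (intro allI impI)
      fix A :: "nat set" assume A: "finite A"
      \<comment> \<open>The gauge of a maximum is one of the two gauges, hence at most their
        sum.\<close>
      have "log_gauge a (s n) \<le> log_gauge a (diamN N (C n)) + \<kappa> * (1/2) ^ Suc n" for n
        using log_gauge_nonneg[of a "\<tau> n"] log_gauge_nonneg[of a "diamN N (C n)"] \<tau>(3)[of n]
        by (auto simp: s_def max_def)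
      then have "(\<Sum>n\<in>A. log_gauge a (s n)) \<le> (\<Sum>n\<in>A. log_gauge a (diamN N (C n)) + \<kappa> * (1/2) ^ Suc n)"
        by (intro sum_mono)
      also have "\<dots> = (\<Sum>n\<in>A. log_gauge a (diamN N (C n))) + \<kappa> * (\<Sum>n\<in>A. (1/2) ^ Suc n)"
        by (simp add: sum.distrib sum_distrib_left)
      also have "\<dots> \<le> \<kappa> + \<kappa> * 1"
      proof (intro add_mono sum_diam A mult_left_mono)
        have "(\<Sum>n\<in>A. (1/2) ^ Suc n) \<le> (\<Sum>n. (1/2::real) ^ Suc n)"
          using A power_half_series by (intro sum_le_suminf) (auto simp: sums_iff)
        then show "(\<Sum>n\<in>A. (1/2) ^ Suc n) \<le> (1::real)" using power_half_series by (simp add: sums_iff)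
      qed (use \<open>0 < \<kappa>\<close> in auto)
      finally show "(\<Sum>n\<in>A. log_gauge a (s n)) \<le> c * log_gauge a \<rho>" by (simp add: \<kappa>_def)
    qed
    have s: "0 < s n" "s n \<le> exp (- 1 / a)" for n
      using \<tau>(1,2)[of n] C(3)[of n] by (auto simp: s_def \<delta>_def)
    have "N (y - y') \<le> s n" if "y \<in> C n" "y' \<in> C n" for n y y'
      using dist_le_diamN[OF C(2) that] by (simp add: s_def)
    then have "\<exists>y\<in>F_set N I x r t \<inter> U. \<forall>n. y \<notin> C n"
      using exists_uncovered[OF hu t a_def c_def s(1) _ s(2) \<rho> sub hit] by blast
    then show False using C(1) by blast
  qed
  also have "\<dots> \<le> hausdorff_g N (log_gauge a) (F_set N I x r t \<inter> U)"
    unfolding hausdorff_g_def using \<delta> by (intro SUP_upper) auto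
  finally show ?thesis using \<open>0 < \<kappa>\<close> by (simp add: less_le_trans[of 0 "ennreal \<kappa>"])
qed

text \<open>For \<open>s < a\<close> the gauge is below \<open>\<rho> powr s\<close> near 0, so the
  \<open>s\<close>-dimensional measure of \<open>E\<close> is positive too and \<open>s\<close> does
  not enter the infimum.\<close>

lemma hausdorff_dim_ge:
  assumes "0 < hausdorff_g N (log_gauge a) E"
  shows "ereal a \<le> hausdorff_dim N E"
  unfolding hausdorff_dim_def
proof (rule INF_greatest, rule ccontr)
  fix s assume s: "s \<in> {s. 0 \<le> s \<and> hausdorff_g N (\<lambda>\<rho>. \<rho> powr s) E = 0}" and "\<not> ereal a \<le> ereal s"
  then have "s < a" by simp
  then obtain \<delta> where "0 < \<delta>" "\<And>\<rho>. 0 \<le> \<rho> \<Longrightarrow> \<rho> \<le> \<delta> \<Longrightarrow> log_gauge a \<rho> \<le> \<rho> powr s"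
    using log_gauge_le_powr by blast
  then have "hausdorff_g N (log_gauge a) E \<le> hausdorff_g N (\<lambda>\<rho>. \<rho> powr s) E"
    by (rule hausdorff_g_mono)
  with s assms show False by simp
qed

end

theorem theorem4p2:
  fixes N :: "'a::euclidean_space \<Rightarrow> real"
    and I :: "'i set" and x :: "'i \<Rightarrow> 'a" and r :: "'i \<Rightarrow> real" and U :: "'a set"
    and t :: real
  assumes "is_norm N"
    and "homogeneous_ubiquitous N I x r U"
    and "t > 1"
  shows "hausdorff_g N (\<lambda>\<rho>. \<rho> powr (real DIM('a) / t) * \<bar>ln \<rho>\<bar>) (F_set N I x r t \<inter> U) > 0
       \<and> hausdorff_dim N (F_set N I x r t \<inter> U) \<ge> ereal (real DIM('a) / t)"
proof -
  interpret equivalent_norm N using assms(1) by unfold_locales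
  have "0 < hausdorff_g N (log_gauge (real DIM('a) / t)) (F_set N I x r t \<inter> U)"
    using assms(2,3) refl by (rule hausdorff_g_log_gauge_pos)
  moreover have "log_gauge (real DIM('a) / t) = (\<lambda>\<rho>. \<rho> powr (real DIM('a) / t) * \<bar>ln \<rho>\<bar>)"
    by (simp add: fun_eq_iff log_gauge_def)
  ultimately show ?thesis using hausdorff_dim_ge[of "real DIM('a) / t"] by simp
qed

end
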